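(* Let $J:(0,\infty)\to\mathbb{R}$ be non-constant and satisfy, for all $x,y>0$, $$J(xy)+J(x/y)=2J(x)+2J(y)+2J(x)J(y).$$ Then $J(1)=0$.
   Context: The displayed functional equation is called the Recognition Composition Law (RCL). *)

theory Defs
  imports "HOL-Analysis.Analysis"
begin

end

theory Submission
  imports Defs
begin

text \<open>
  At \<open>y = 1\<close> both terms on the left of the composition law equal \<open>J x\<close>, so the law collapses
  to \<open>J 1 * (1 + J x) = 0\<close> for every \<open>x > 0\<close>. A nonzero \<open>J 1\<close> would therefore force \<open>J\<close> to be
  the constant \<open>-1\<close>.
\<close>

theorem propositionA1:
  fixes J :: "real \<Rightarrow> real"
  assumes nonconst: "\<not> J constant_on {0<..}"
    and RCL: "\<And>x y. x > 0 \<Longrightarrow> y > 0 \<Longrightarrow>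
      J (x * y) + J (x / y) = 2 * J x + 2 * J y + 2 * J x * J y"
  shows "J 1 = 0"
proof (rule ccontr)
  assume nonzero: "J 1 \<noteq> 0"
  have "J x = -1" if "x > 0" for x
  proof -
    have "J 1 * (1 + J x) = 0"
      using RCL[OF that, of 1] by (simp add: algebra_simps)
    with nonzero show ?thesis by simp
  qed
  then have "J constant_on {0<..}"
    unfolding constant_on_def by auto
  with nonconst show False ..
qed

end
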